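(* Let $\mathcal D$ be a doctrine on a finite set of literals $\Pi$, let $v$ be any valuation and $v^*$ its upper revised valuation with respect to $\mathcal D$. For every $\eta$ with $0\le\eta\le1$, the decision of margin $\eta$ associated with $v^*$, that is, the partial truth assignment $\mu_\eta(v^* )$, is definitely consistent with $\mathcal D$.
   Context: $\Pi_+$ is a finite nonempty set of atoms; $\Pi=\bigcup_{p\in\Pi_+}\{p,\overline p\}$ is the set of literals, where $p\mapsto\overline p$ is negation and $\overline{\overline p}=p$. A clause is a subset $C\subseteq\Pi$, read as the disjunction $\bigvee_{p\in C}p$. A doctrine is a collection $\mathcal D$ of clauses, read as the conjunctive normal form $\bigwedge_{C\in\mathcal D}\bigvee_{p\in C}p$. Standing assumptions: (D1) this formula is satisfiable; (D2) no clause in $\mathcal D$ consists of a single literal; (D3) $\{p,\overline p\}\in\mathcal D$ for every $p\in\Pi_+$. A valuation is a map $w:\Pi\to[0,1]$, $p\mapsto w_p$. For a valuation $v$ define $v'$ by $$v'_p=\max_{C\in\mathcal D,\ C\ni p}\ \min_{\alpha\in C,\ \alpha\neq p} v_{\overline\alpha}.$$ Put $v^{(0)}=v$ and $v^{(n+1)}=(v^{(n)})'$. This sequence is non-decreasing and takes values in the finite set $\{v_\alpha:\alpha\in\Pi\}$, so it is eventually constant; its eventual value is the upper revised valuation $v^*$. A partial truth assignment is a valuation $u$ with values in $\{0,\tfrac12,1\}$ and $u_p+u_{\overline p}=1$ for all $p$ (values $1,0,\tfrac12$ mean accepted, rejected, undecided). It is definitely consistent with $\mathcal D$ when, for each $C\in\mathcal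 D$ and every $p\in C$: if $u_\alpha=0$ for every $\alpha\in C\setminus\{p\}$, then $u_p=1$. For a valuation $w$ and $0\le\eta\le1$, the decision of margin $\eta$ is the partial truth assignment $\mu_\eta(w)$ with, for each $p\in\Pi$: $\mu_\eta(w)_p=1$ and $\mu_\eta(w)_{\overline p}=0$ if $w_p-w_{\overline p}>\eta$; $\mu_\eta(w)_p=\mu_\eta(w)_{\overline p}=\tfrac12$ if $|w_p-w_{\overline p}|\le\eta$. *)

theory Defs
  imports Complex_Main
begin

datatype 'a lit = Pos 'a | Neg 'a

fun neg :: "'a lit \<Rightarrow> 'a lit" where
  "neg (Pos a) = Neg a"
| "neg (Neg a) = Pos a"

lemma neg_neg [simp]: "neg (neg p) = p"
  by (cases p) auto

definition literals :: "'a set \<Rightarrow> 'a lit set" where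
  "literals A = Pos ` A \<union> Neg ` A"

type_synonym 'a clause = "'a lit set"

fun lit_true :: "('a \<Rightarrow> bool) \<Rightarrow> 'a lit \<Rightarrow> bool" where
  "lit_true t (Pos a) \<longleftrightarrow> t a"
| "lit_true t (Neg a) \<longleftrightarrow> \<not> t a"

definition satisfiable :: "'a clause set \<Rightarrow> bool" where
  "satisfiable D \<longleftrightarrow> (\<exists>t. \<forall>C\<in>D. \<exists>p\<in>C. lit_true t p)"

locale doctrine =
  fixes A :: "'a set" and D :: "'a clause set"
  assumes finite_atoms: "finite A"
    and atoms_nonempty: "A \<noteq> {}"
    and clauses: "C \<in> D \<Longrightarrow> C \<subseteq> literals A"
    and D1: "satisfiable D"
    and D2: "C \<in> D \<Longrightarrow> C \<noteq> {p}"
    and D3: "a \<in> A \<Longrightarrow> {Pos a, Neg a} \<in> D"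

text \<open>
  Valuations live on \<^term>\<open>literals A\<close>; all notions below only look at their values there.
\<close>

definition valuation :: "'a set \<Rightarrow> ('a lit \<Rightarrow> real) \<Rightarrow> bool" where
  "valuation A w \<longleftrightarrow> (\<forall>p\<in>literals A. 0 \<le> w p \<and> w p \<le> 1)"

text \<open>
  For a doctrine and \<^term>\<open>p \<in> literals A\<close>, both the maximum and the minima range over
  finite nonempty sets: \<open>p\<close> lies in the clause \<^term>\<open>{p, neg p}\<close>, and no clause is a
  singleton.
\<close>

definition revise :: "'a clause set \<Rightarrow> ('a lit \<Rightarrow> real) \<Rightarrow> 'a lit \<Rightarrow> real" where
  "revise D v p = Max ((\<lambda>C. Min ((\<lambda>\<alpha>. v (neg \<alpha>)) ` (C - {p}))) ` {C \<in> D. p \<in> C})"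

text \<open>
  The eventual value of the iterates; that it exists for a doctrine is
  \<open>eventually_upper_revised\<close> below.
\<close>

definition upper_revised :: "'a clause set \<Rightarrow> ('a lit \<Rightarrow> real) \<Rightarrow> 'a lit \<Rightarrow> real" where
  "upper_revised D v p = (THE x. \<forall>\<^sub>F n in sequentially. (revise D ^^ n) v p = x)"

definition partial_truth_assignment :: "'a set \<Rightarrow> ('a lit \<Rightarrow> real) \<Rightarrow> bool" where
  "partial_truth_assignment A u \<longleftrightarrow>
     valuation A u \<and> (\<forall>p\<in>literals A. u p \<in> {0, 1/2, 1} \<and> u p + u (neg p) = 1)"

definition definitely_consistent :: "'a clause set \<Rightarrow> ('a lit \<Rightarrow> real) \<Rightarrow> bool" where
  "definitely_consistent D u \<longleftrightarrow>
     (\<forall>C\<in>D. \<forall>p\<in>C. (\<forall>\<alpha>\<in>C - {p}. u \<alpha> = 0) \<longrightarrow> u p = 1)"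

definition decision :: "real \<Rightarrow> ('a lit \<Rightarrow> real) \<Rightarrow> 'a lit \<Rightarrow> real" where
  "decision \<eta> w p =
     (if w p - w (neg p) > \<eta> then 1
      else if w (neg p) - w p > \<eta> then 0
      else 1/2)"

lemma neg_in_literals [simp]: "neg p \<in> literals A \<longleftrightarrow> p \<in> literals A"
  by (cases p) (auto simp: literals_def)

context doctrine
begin

lemma finite_literals: "finite (literals A)"
  using finite_atoms by (simp add: literals_def)

lemma finite_doctrine: "finite D"
  using finite_subset[of D "Pow (literals A)"] clauses finite_literals by auto

lemma finite_clause: "C \<in> D \<Longrightarrow> finite C"
  using finite_subset[OF clauses finite_literals] .

lemma clause_minus_nonempty: "C \<in> D \<Longrightarrow> p \<in> C \<Longrightarrow> C - {p} \<noteq> {}"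
  using D2[of C p] by auto

lemma excluded_middle_clause: "p \<in> literals A \<Longrightarrow> {p, neg p} \<in> D"
  using D3 by (cases p) (auto simp: literals_def insert_commute)

lemma revise_ge:
  assumes "p \<in> literals A"
  shows "v p \<le> revise D v p"
proof -
  let ?m = "\<lambda>C. Min ((\<lambda>\<alpha>. v (neg \<alpha>)) ` (C - {p}))"
  have "{p, neg p} - {p} = {neg p}" by (cases p) auto
  then have eq: "?m {p, neg p} = v p" by simp
  have "{p, neg p} \<in> {C \<in> D. p \<in> C}"
    using excluded_middle_clause[OF assms] by blast
  then have mem: "?m {p, neg p} \<in> ?m ` {C \<in> D. p \<in> C}"
    by (rule imageI)
  have "finite (?m ` {C \<in> D. p \<in> C})"
    using finite_doctrine by simp
  from Max_ge[OF this mem] show ?thesis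
    unfolding eq revise_def .
qed

lemma revise_in_values:
  assumes "p \<in> literals A"
  shows "revise D v p \<in> v ` literals A"
proof -
  let ?m = "\<lambda>C. Min ((\<lambda>\<alpha>. v (neg \<alpha>)) ` (C - {p}))"
  have "revise D v p \<in> ?m ` {C \<in> D. p \<in> C}"
    unfolding revise_def using excluded_middle_clause[OF assms] finite_doctrine
    by (intro Max_in) auto
  then obtain C where C: "C \<in> D" "p \<in> C" "revise D v p = ?m C" by auto
  have "?m C \<in> (\<lambda>\<alpha>. v (neg \<alpha>)) ` (C - {p})"
    using C finite_clause clause_minus_nonempty by (intro Min_in) auto
  moreover have "\<dots> \<subseteq> v ` literals A"
    using clauses[OF C(1)] by auto
  ultimately show ?thesis using C(3) by auto
qed

lemma eventually_upper_revised:
  assumes "p \<in> literals A"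
  shows "\<forall>\<^sub>F n in sequentially. (revise D ^^ n) v p = upper_revised D v p"
proof -
  let ?f = "\<lambda>n. (revise D ^^ n) v p"
  have vals: "(revise D ^^ n) v q \<in> v ` literals A" if "q \<in> literals A" for n q
    using that
  proof (induction n arbitrary: q)
    case (Suc n)
    then show ?case using revise_in_values[OF Suc.prems, of "(revise D ^^ n) v"] by auto
  qed auto
  have fin: "finite (range ?f)"
  proof (rule finite_subset)
    show "range ?f \<subseteq> v ` literals A" using vals[OF assms] by blast
    show "finite (v ` literals A)" using finite_literals by (rule finite_imageI)
  qed
  have mono: "incseq ?f"
    using revise_ge[OF assms] by (intro incseq_SucI) simp
  have "Max (range ?f) \<in> range ?f"
    using Max_in[OF fin] by blast
  then obtain N where N: "?f N = Max (range ?f)"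
    by (elim rangeE) (erule that[OF sym])
  have "?f n = ?f N" if "n \<ge> N" for n
  proof (rule antisym)
    show "?f n \<le> ?f N" unfolding N by (rule Max_ge[OF fin]) (rule rangeI)
    show "?f N \<le> ?f n" by (rule incseqD[OF mono that])
  qed
  then have ev: "\<forall>\<^sub>F n in sequentially. ?f n = ?f N"
    unfolding eventually_sequentially by blast
  have uniq: "x = ?f N" if "\<forall>\<^sub>F n in sequentially. ?f n = x" for x
  proof -
    have "\<exists>n. ?f n = x \<and> ?f n = ?f N"
      using eventually_happens'[OF sequentially_bot eventually_conj[OF that ev]] .
    then show ?thesis by metis
  qed
  have "upper_revised D v p = ?f N"
    unfolding upper_revised_def
    by (rule the_equality[where P = "\<lambda>x. \<forall>\<^sub>F n in sequentially. ?f n = x", OF ev uniq])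
  then show ?thesis using ev by simp
qed

end

end

theory Submission
  imports Defs
begin

text \<open>
  Since \<open>w = v\<^sup>*\<close> is a fixed point of revision, every clause \<open>C\<close> and every \<open>p \<in> C\<close> admit some
  \<open>\<alpha> \<in> C - {p}\<close> with \<open>w (neg \<alpha>) \<le> w p\<close>; take \<open>\<alpha>\<close> minimizing \<open>w (neg \<alpha>)\<close>. If all literals of
  \<open>C - {p}\<close> are rejected, then \<open>w \<alpha> < w (neg \<alpha>) \<le> w (neg \<beta>)\<close> for all \<open>\<beta> \<in> C - {p}\<close>, so the same
  inequality applied to \<open>\<alpha>\<close> instead of \<open>p\<close> can only hold because of \<open>w (neg p) \<le> w \<alpha>\<close>. Hence
  \<open>w p - w (neg p) \<ge> w (neg \<alpha>) - w \<alpha> > \<eta>\<close>.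
\<close>

context doctrine
begin

text \<open>Clauses stay inside \<open>literals A\<close>, the only place where the iterates are
  known to reach \<open>upper_revised\<close>.\<close>

lemma revise_cong:
  assumes "\<And>q. q \<in> literals A \<Longrightarrow> v q = w q"
  shows "revise D v p = revise D w p"
proof -
  have "(\<lambda>\<alpha>. v (neg \<alpha>)) ` (C - {p}) = (\<lambda>\<alpha>. w (neg \<alpha>)) ` (C - {p})" if "C \<in> D" for C
    using clauses[OF that] assms by (intro image_cong) auto
  then show ?thesis
    unfolding revise_def by (intro arg_cong[where f = Max] image_cong) auto
qed

lemma revise_upper_revised:
  assumes p: "p \<in> literals A"
  shows "revise D (upper_revised D v) p = upper_revised D v p"
proof -
  let ?w = "upper_revised D v" and ?f = "\<lambda>n. (revise D ^^ n) v"
  \<comment> \<open>There are finitely many literals, so a single index \<open>N\<close> works for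
    all of them at once.\<close>
  have "\<forall>\<^sub>F n in sequentially. \<forall>q\<in>literals A. ?f n q = ?w q"
    using finite_literals eventually_upper_revised by (simp add: eventually_ball_finite)
  then obtain N where N: "\<And>n q. N \<le> n \<Longrightarrow> q \<in> literals A \<Longrightarrow> ?f n q = ?w q"
    unfolding eventually_sequentially by blast
  have "revise D ?w p = revise D (?f N) p"
    using N by (intro revise_cong) simp
  also have "\<dots> = ?w p"
    using N[of "Suc N" p] p by simp
  finally show ?thesis .
qed

lemma clause_min_le_revise:
  assumes "C \<in> D" "p \<in> C"
  obtains \<alpha> where "\<alpha> \<in> C - {p}" "v (neg \<alpha>) \<le> revise D v p"
    "\<And>\<beta>. \<beta> \<in> C - {p} \<Longrightarrow> v (neg \<alpha>) \<le> v (neg \<beta>)"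
proof -
  let ?S = "\<lambda>C. (\<lambda>\<alpha>. v (neg \<alpha>)) ` (C - {p})"
  have fin: "finite (?S C)" using finite_clause[OF assms(1)] by simp
  then have "Min (?S C) \<in> ?S C"
    using clause_minus_nonempty[OF assms] by (intro Min_in) auto
  then obtain \<alpha> where \<alpha>: "\<alpha> \<in> C - {p}" "Min (?S C) = v (neg \<alpha>)" by auto
  have "Min (?S C) \<le> revise D v p"
    unfolding revise_def using assms finite_doctrine by (intro Max_ge) auto
  moreover have "Min (?S C) \<le> v (neg \<beta>)" if "\<beta> \<in> C - {p}" for \<beta>
    using fin that by (intro Min_le) auto
  ultimately show thesis using that \<alpha> by simp
qed

lemma fixed_point_margin:
  assumes fixed: "\<And>q. q \<in> literals A \<Longrightarrow> revise D w q = w q"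
    and \<eta>: "0 \<le> \<eta>" and C: "C \<in> D" "p \<in> C"
    and rejected: "\<And>\<alpha>. \<alpha> \<in> C - {p} \<Longrightarrow> \<eta> < w (neg \<alpha>) - w \<alpha>"
  shows "\<eta> < w p - w (neg p)"
proof -
  obtain \<alpha> where \<alpha>: "\<alpha> \<in> C - {p}" "w (neg \<alpha>) \<le> revise D w p"
    and min: "\<And>\<beta>. \<beta> \<in> C - {p} \<Longrightarrow> w (neg \<alpha>) \<le> w (neg \<beta>)"
    using clause_min_le_revise[OF C, of w] by blast
  obtain \<beta> where \<beta>: "\<beta> \<in> C - {\<alpha>}" "w (neg \<beta>) \<le> revise D w \<alpha>"
    using clause_min_le_revise[OF C(1), of \<alpha> w] \<alpha>(1) by blast
  have lits: "p \<in> literals A" "\<alpha> \<in> literals A"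
    using clauses[OF C(1)] C(2) \<alpha>(1) by auto
  have "\<beta> = p"
  proof (rule ccontr)
    assume "\<beta> \<noteq> p"
    then have "w (neg \<alpha>) \<le> w (neg \<beta>)" using min \<beta>(1) by blast
    \<comment> \<open>Now \<open>w (neg \<alpha>)\<close> \<le> \<open>w (neg \<beta>)\<close> \<le>
      \<open>w \<alpha>\<close>, against the rejection of \<open>\<alpha>\<close>.\<close>
    then show False using rejected[OF \<alpha>(1)] \<beta>(2) fixed[OF lits(2)] \<eta> by simp
  qed
  then show ?thesis
    using rejected[OF \<alpha>(1)] \<alpha>(2) \<beta>(2) fixed[OF lits(1)] fixed[OF lits(2)] by simp
qed

end

text \<open>With \<eta> \<ge> 0 a literal and its negation cannot both exceed the margin, so their
  values sum to 1.\<close>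

lemma partial_truth_assignment_decision:
  assumes "0 \<le> \<eta>"
  shows "partial_truth_assignment A (decision \<eta> w)"
  using assms by (auto simp: partial_truth_assignment_def valuation_def decision_def)

theorem corollary3p7:
  fixes A :: "'a set" and D :: "'a clause set" and v :: "'a lit \<Rightarrow> real" and \<eta> :: real
  assumes "doctrine A D"
    and "valuation A v"
    and "0 \<le> \<eta>" and "\<eta> \<le> 1"
  shows "partial_truth_assignment A (decision \<eta> (upper_revised D v)) \<and>
         definitely_consistent D (decision \<eta> (upper_revised D v))"
proof -
  interpret doctrine A D by fact
  let ?w = "upper_revised D v"
  have "decision \<eta> ?w p = 1"
    if C: "C \<in> D" "p \<in> C" and zero: "\<forall>\<alpha>\<in>C - {p}. decision \<eta> ?w \<alpha> = 0" for C p
  proof -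
    \<comment> \<open>Only the second branch of \<open>decision\<close> yields 0.\<close>
    have "\<eta> < ?w (neg \<alpha>) - ?w \<alpha>" if "\<alpha> \<in> C - {p}" for \<alpha>
      using zero that unfolding decision_def by (metis zero_neq_one half_gt_zero_iff less_irrefl zero_less_one)
    from fixed_point_margin[OF revise_upper_revised assms(3) C this]
    show ?thesis by (simp add: decision_def)
  qed
  then show ?thesis
    using partial_truth_assignment_decision[OF assms(3)]
    by (auto simp: definitely_consistent_def)
qed

end
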